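(* Let $F(x,y,z)=(A(x,y),g(z+r(x)))$ on $\mathbb T^2\times\mathbb T$ with $A,g,r$ as in the context, satisfying assumptions (A1)-(A3) stated in the context. Let $$a=\frac{2\lambda_g^{max}C}{\alpha^u_{min}-\lambda_g^{max}},\qquad b=\frac{\lambda_g^{min}c\,\beta}{\alpha^u_{max}} .$$ Then there exists $c_0>0$ such that the following hold at every $p\in\mathbb T^2\times\mathbb T$: (i) $DF_p(\mathcal C^u_{0,a}(p))\subset\mathcal C^u_{b,a-\sigma}(Fp)$ for some small $\sigma>0$; (ii) for all $v\in\mathcal C^u_{0,a}(p)$, $\|DF^n_pv\|\ge c_0(\lambda_A)^{-n}\|v\|$ for all $n\ge0$.
   Context: $\mathbb T=\mathbb R/\mathbb Z$; $\partial_x,\partial_y,\partial_z$ are the unit coordinate vectors. The map $A$: $A:\mathbb T^2\to\mathbb T^2$ is a $C^2$ Anosov diffeomorphism with $DA$-invariant splitting $T_{\mathrm p}\mathbb T^2=E^s_A(\mathrm p)\oplus E^u_A(\mathrm p)$ into one-dimensional subspaces, and there is $\lambda_A<1$ such that for all $\mathrm p\in\mathbb T^2$, $\|DA_{\mathrm p}w\|\le\lambda_A\|w\|$ for $w\in E^s_A(\mathrm p)$ and $\|D(A^{-1})_{\mathrm p}v\|\le\lambda_A\|v\|$ for $v\in E^u_A(\mathrm p)$. The map $g$: $g:\mathbb T\to\mathbb T$ is a $C^2$ map with $g'>0$ (orientation-preserving diffeomorphism) with exactly two fixed points, a repelling one $z_r$ and an attracting one $z_a$; for all $z\in\mathbb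 T\setminus\{z_a,z_r\}$, $g^nz\to z_a$ and $g^{-n}z\to z_r$ as $n\to\infty$; and $\lambda_g^{max}:=\max g'=g'(z_r)$, $\lambda_g^{min}:=\min g'=g'(z_a)$. The map $r:\mathbb T\to\mathbb T$ is an orientation-preserving diffeomorphism. Assumptions: (A1) $\lambda_A<\lambda_g^{min}<1<\lambda_g^{max}<(\lambda_A)^{-1}$. (A2) $r$ is $C^2$ with $c\le r'\le C$ for some $c,C>0$. (A3) (i) $E^u_A(\mathrm p)$ and $E^s_A(\mathrm p)$ are nowhere aligned with the $y$-axis. Let $\partial^u_A(\mathrm p)$ be the unit vector in $E^u_A(\mathrm p)$ with positive $x$-component and $\partial^s_A(\mathrm p)$ the unit vector in $E^s_A(\mathrm p)$ with negative $x$-component; $\beta>0$ is such that $\partial^u_A(\mathrm p)\cdot\partial_x\ge\beta$ and $\partial^s_A(\mathrm p)\cdot\partial_x\le-\beta$ for all $\mathrm p\in\mathbb T^2$. (ii) Let $\alpha^u,\alpha^s$ be the functions on $\mathbb T^2$ with $DA_{\mathrm p}(\partial^u_A(\mathrm p))=\alpha^u(\mathrm p)\partial^u_A(A\mathrm p)$ and $DA_{\mathrm p}(\partial^s_A(\mathrm p))=\alpha^s(\mathrm p)\partial^s_A(A\mathrm p)$; assume $\alpha^u,\alpha^s>0$, and let $\alpha^{u}_{max},\alpha^u_{min}$ (resp. $\alpha^s_{max},\alpha^s_{min}$) be the maximum and minimum of $\alpha^u$ (resp. $\alpha^s$). Cones: put $E^{cu}:=E^u_A\oplus\langle\partial_z\rangle$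 (a $DF$-invariant plane field) and $\partial_u(x,y,z):=(\partial^u_A(x,y),0)$. For $v\in E^{cu}(p)$ write $v=(v^u,v^z)$ for its components in the basis $\{\partial_u(p),\partial_z\}$. For $0\le s<t\le\infty$, $$\mathcal C^u_{s,t}(p):=\{v\in E^{cu}(p):\ v^u,v^z\ge0\ \text{and}\ s\,v^u\le v^z\le t\,v^u\}.$$ *)

theory Defs
  imports "HOL-Analysis.Analysis"
begin

quotient_type circle = real / "\<lambda>x y. x - y \<in> \<int>"
proof (rule equivpI)
  show "reflp (\<lambda>x y :: real. x - y \<in> \<int>)"
    by (simp add: reflp_def)
  show "symp (\<lambda>x y :: real. x - y \<in> \<int>)"
    by (metis (no_types, lifting) Ints_minus minus_diff_eq sympI)
  show "transp (\<lambda>x y :: real. x - y \<in> \<int>)"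
  proof (rule transpI)
    fix x y z :: real
    assume "x - y \<in> \<int>" "y - z \<in> \<int>"
    then have "(x - y) + (y - z) \<in> \<int>" by (rule Ints_add)
    then show "x - z \<in> \<int>" by simp
  qed
qed

lift_definition to_circle :: "real \<Rightarrow> circle" is "\<lambda>x. x" .

instantiation circle :: ab_group_add
begin

lift_definition zero_circle :: circle is 0 .

lift_definition plus_circle :: "circle \<Rightarrow> circle \<Rightarrow> circle" is "(+)"
  by (metis Ints_add add_diff_add)

lift_definition uminus_circle :: "circle \<Rightarrow> circle" is uminus
  by (metis Ints_minus minus_diff_minus)

lift_definition minus_circle :: "circle \<Rightarrow> circle \<Rightarrow> circle" is "(-)"
proof -
  fix x x' y y' :: real
  assume "x - x' \<in> \<int>" "y - y' \<in> \<int>"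
  then have "(x - x') - (y - y') \<in> \<int>" by (rule Ints_diff)
  then show "x - y - (x' - y') \<in> \<int>" by (simp add: algebra_simps)
qed

instance
  by standard (transfer, simp add: algebra_simps)+

end

(* quotient topology *)
instantiation circle :: topological_space
begin

definition open_circle :: "circle set \<Rightarrow> bool" where
  "open_circle U \<longleftrightarrow> open (to_circle -` U)"

instance
proof
  show "open (UNIV :: circle set)"
    by (simp add: open_circle_def)
  show "open (S \<inter> T)" if "open S" "open T" for S T :: "circle set"
    using that by (auto simp: open_circle_def vimage_Int)
  show "open (\<Union>K)" if "\<forall>S\<in>K. open S" for K :: "circle set set"
    using that by (auto simp: open_circle_def vimage_Union)
qed

end

type_synonym torus2 = "circle \<times> circle"
type_synonym torus3 = "torus2 \<times> circle"

definition to_torus2 :: "real \<times> real \<Rightarrow> torus2" where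
  "to_torus2 = map_prod to_circle to_circle"

definition to_torus3 :: "(real \<times> real) \<times> real \<Rightarrow> torus3" where
  "to_torus3 = map_prod to_torus2 to_circle"

(* Differential calculus on tori, for the covering homomorphisms pi : 'a -> 's and rho : 'b -> 't
   of the source and target torus.  The tangent space at every point is identified with 'a
   (resp. 'b) by translation, so that phi below is a lift to the covering spaces of the map
   f translated to the origins; phi is determined near 0 by its continuity at 0. *)
definition has_torus_derivative ::
  "('a::real_normed_vector \<Rightarrow> 's::ab_group_add) \<Rightarrow> ('b::real_normed_vector \<Rightarrow> 't::ab_group_add)
    \<Rightarrow> ('s \<Rightarrow> 't) \<Rightarrow> ('a \<Rightarrow> 'b) \<Rightarrow> 's \<Rightarrow> bool" where
  "has_torus_derivative \<pi> \<rho> f L p \<longleftrightarrow>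
     (\<exists>\<phi>. \<phi> 0 = 0 \<and> (\<phi> has_derivative L) (at 0) \<and> (\<forall>h. f (p + \<pi> h) = f p + \<rho> (\<phi> h)))"

definition torus_derivative ::
  "('a::real_normed_vector \<Rightarrow> 's::ab_group_add) \<Rightarrow> ('b::real_normed_vector \<Rightarrow> 't::ab_group_add)
    \<Rightarrow> ('s \<Rightarrow> 't) \<Rightarrow> 's \<Rightarrow> 'a \<Rightarrow> 'b" where
  "torus_derivative \<pi> \<rho> f p = (THE L. has_torus_derivative \<pi> \<rho> f L p)"

definition C1_map :: "('a::real_normed_vector \<Rightarrow> 'b::real_normed_vector) \<Rightarrow> bool" where
  "C1_map f \<longleftrightarrow>
     (\<exists>f'. (\<forall>x. (f has_derivative blinfun_apply (f' x)) (at x)) \<and> continuous_on UNIV f')"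

definition C2_torus_map ::
  "('a::real_normed_vector \<Rightarrow> 's::ab_group_add) \<Rightarrow> ('b::real_normed_vector \<Rightarrow> 't::ab_group_add)
    \<Rightarrow> ('s \<Rightarrow> 't) \<Rightarrow> bool" where
  "C2_torus_map \<pi> \<rho> f \<longleftrightarrow>
     (\<exists>D. (\<forall>p. has_torus_derivative \<pi> \<rho> f (blinfun_apply (D p)) p) \<and> C1_map (\<lambda>x. D (\<pi> x)))"

definition C2_torus_diffeo ::
  "('a::real_normed_vector \<Rightarrow> 's::ab_group_add) \<Rightarrow> ('s \<Rightarrow> 's) \<Rightarrow> bool" where
  "C2_torus_diffeo \<pi> f \<longleftrightarrow> bij f \<and> C2_torus_map \<pi> \<pi> f \<and> C2_torus_map \<pi> \<pi> (inv f)"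

abbreviation D2 :: "(torus2 \<Rightarrow> torus2) \<Rightarrow> torus2 \<Rightarrow> real \<times> real \<Rightarrow> real \<times> real" where
  "D2 \<equiv> torus_derivative to_torus2 to_torus2"

abbreviation D3 ::
  "(torus3 \<Rightarrow> torus3) \<Rightarrow> torus3 \<Rightarrow> (real \<times> real) \<times> real \<Rightarrow> (real \<times> real) \<times> real" where
  "D3 \<equiv> torus_derivative to_torus3 to_torus3"

definition circle_deriv :: "(circle \<Rightarrow> circle) \<Rightarrow> circle \<Rightarrow> real" where
  "circle_deriv f z = torus_derivative to_circle to_circle f z 1"

definition orientation_preserving_C2_diffeo :: "(circle \<Rightarrow> circle) \<Rightarrow> bool" where
  "orientation_preserving_C2_diffeo f \<longleftrightarrow>
     C2_torus_diffeo to_circle f \<and> (\<forall>z. circle_deriv f z > 0)"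

definition anosov_diffeo ::
  "(torus2 \<Rightarrow> torus2) \<Rightarrow> (torus2 \<Rightarrow> (real \<times> real) set) \<Rightarrow> (torus2 \<Rightarrow> (real \<times> real) set)
    \<Rightarrow> real \<Rightarrow> bool" where
  "anosov_diffeo A Es Eu lamA \<longleftrightarrow>
     C2_torus_diffeo to_torus2 A \<and>
     (\<forall>p. subspace (Es p) \<and> dim (Es p) = 1 \<and> subspace (Eu p) \<and> dim (Eu p) = 1) \<and>
     (\<forall>p. Es p \<inter> Eu p = {0} \<and> {v + w | v w. v \<in> Es p \<and> w \<in> Eu p} = UNIV) \<and>
     (\<forall>p. D2 A p ` Es p = Es (A p) \<and> D2 A p ` Eu p = Eu (A p)) \<and>
     lamA < 1 \<and>
     (\<forall>p. \<forall>w\<in>Es p. norm (D2 A p w) \<le> lamA * norm w) \<and>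
     (\<forall>p. \<forall>v\<in>Eu p. norm (D2 (inv A) p v) \<le> lamA * norm v)"

definition attracting_fixed_point :: "('a::topological_space \<Rightarrow> 'a) \<Rightarrow> 'a \<Rightarrow> bool" where
  "attracting_fixed_point f z \<longleftrightarrow>
     f z = z \<and> (\<forall>\<^sub>F w in nhds z. (\<lambda>n. (f ^^ n) w) \<longlonglongrightarrow> z)"

(* The last clause says that the maximum and minimum of g' are g'(zr) and g'(za). *)
definition north_south_diffeo :: "(circle \<Rightarrow> circle) \<Rightarrow> circle \<Rightarrow> circle \<Rightarrow> bool" where
  "north_south_diffeo g za zr \<longleftrightarrow>
     orientation_preserving_C2_diffeo g \<and>
     za \<noteq> zr \<and> {z. g z = z} = {za, zr} \<and>
     attracting_fixed_point g za \<and> attracting_fixed_point (inv g) zr \<and>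
     (\<forall>z. z \<notin> {za, zr} \<longrightarrow>
        (\<lambda>n. (g ^^ n) z) \<longlonglongrightarrow> za \<and> (\<lambda>n. (inv g ^^ n) z) \<longlonglongrightarrow> zr) \<and>
     (\<forall>z. circle_deriv g za \<le> circle_deriv g z \<and> circle_deriv g z \<le> circle_deriv g zr)"

definition skew_product ::
  "(torus2 \<Rightarrow> torus2) \<Rightarrow> (circle \<Rightarrow> circle) \<Rightarrow> (circle \<Rightarrow> circle) \<Rightarrow> torus3 \<Rightarrow> torus3" where
  "skew_product A g r = (\<lambda>((x, y), z). (A (x, y), g (z + r x)))"

definition Ecu :: "(torus2 \<Rightarrow> (real \<times> real) set) \<Rightarrow> torus3 \<Rightarrow> ((real \<times> real) \<times> real) set" where
  "Ecu Eu p = {(w, 0) + t *\<^sub>R ((0, 0), 1) | w t. w \<in> Eu (fst p)}"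

(* du is the field of unit vectors spanning Eu *)
definition cone_u ::
  "(torus2 \<Rightarrow> (real \<times> real) set) \<Rightarrow> (torus2 \<Rightarrow> real \<times> real) \<Rightarrow> real \<Rightarrow> real \<Rightarrow> torus3
    \<Rightarrow> ((real \<times> real) \<times> real) set" where
  "cone_u Eu du s t p =
     {v \<in> Ecu Eu p. \<exists>vu vz. v = vu *\<^sub>R (du (fst p), 0) + vz *\<^sub>R ((0, 0), 1) \<and>
        vu \<ge> 0 \<and> vz \<ge> 0 \<and> s * vu \<le> vz \<and> vz \<le> t * vu}"

end

theory Submission
  imports Defs
begin

text \<open>
  The differential of the skew product acts in the basis \<open>(du, 0)\<close>, \<open>(0, 1)\<close> by
  \<open>x \<mapsto> \<alpha>u x\<close> and \<open>y \<mapsto> g' (y + r' (fst du) x)\<close>.  The bounds on \<open>g'\<close>, \<open>r'\<close>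
  and \<open>fst du\<close> give the cone inclusion; the slope \<open>a\<close> is chosen so that
  \<open>lamgmax (a + C) = \<alpha>umin a - lamgmax C\<close>, which leaves room for \<open>\<sigma>\<close>.  Contraction by the
  inverse along \<open>Eu\<close> yields \<open>\<alpha>u \<ge> 1 / lamA\<close>, so the first component, which controls the norm
  in the cone, grows at least like \<open>1 / lamA ^ n\<close>.
\<close>

section \<open>Lifts along discrete homomorphisms: uniqueness and chain rule\<close>

text \<open>A discrete kernel makes the covering injective near 0. This is what determines the germ
  at 0 of a continuous lift, and hence the derivative.\<close>

locale discrete_hom = additive f
  for f :: "'a::real_normed_vector \<Rightarrow> 'b::ab_group_add" +
  assumes discrete_kernel: "\<exists>e>0. \<forall>x. norm x < e \<longrightarrow> f x = 0 \<longrightarrow> x = 0"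

text \<open>Two lifts differ by a kernel element at every point. Both are continuous and vanish at
  0, so near 0 the difference is too short to be a nonzero kernel element. The lifts thus agree near
  0 and have the same derivative.\<close>

lemma has_torus_derivative_unique:
  assumes "discrete_hom \<rho>"
    and "has_torus_derivative \<pi> \<rho> f L p" "has_torus_derivative \<pi> \<rho> f L' p"
  shows "L = L'"
proof -
  interpret discrete_hom \<rho> by fact
  obtain \<phi> where \<phi>: "\<phi> 0 = 0" "(\<phi> has_derivative L) (at 0)" "\<And>h. f (p + \<pi> h) = f p + \<rho> (\<phi> h)"
    using assms(2) unfolding has_torus_derivative_def by blast
  obtain \<psi> where \<psi>: "\<psi> 0 = 0" "(\<psi> has_derivative L') (at 0)" "\<And>h. f (p + \<pi> h) = f p + \<rho> (\<psi> h)"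
    using assms(3) unfolding has_torus_derivative_def by blast
  obtain e where e: "e > 0" "\<And>x. norm x < e \<Longrightarrow> \<rho> x = 0 \<Longrightarrow> x = 0"
    using discrete_kernel by blast
  have ker: "\<rho> (\<phi> h - \<psi> h) = 0" for h
    using \<phi>(3)[of h] \<psi>(3)[of h] by (simp add: diff)
  have "((\<lambda>h. \<phi> h - \<psi> h) \<longlongrightarrow> \<phi> 0 - \<psi> 0) (at 0)"
    using has_derivative_continuous[OF \<phi>(2)] has_derivative_continuous[OF \<psi>(2)]
    by (intro tendsto_diff) (auto simp: continuous_at)
  then have "((\<lambda>h. \<phi> h - \<psi> h) \<longlongrightarrow> 0) (at 0)"
    by (simp add: \<phi>(1) \<psi>(1))
  then have "\<forall>\<^sub>F h in at 0. norm (\<phi> h - \<psi> h) < e"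
    using e(1) by (auto simp: tendsto_iff dist_norm)
  then have "\<forall>\<^sub>F h in at 0. \<phi> h = \<psi> h"
    by eventually_elim (use e(2) ker in fastforce)
  \<comment> \<open>The filter \<open>at 0\<close> omits 0 itself; agreement there comes from both
    lifts vanishing at 0.\<close>
  then have "(\<psi> has_derivative L) (at 0)"
    using has_derivative_transform_eventually[OF \<phi>(2), of \<psi>] \<phi>(1) \<psi>(1) by simp
  then show ?thesis
    using has_derivative_unique \<psi>(2) by blast
qed

lemma torus_derivative_eqI:
  assumes "discrete_hom \<rho>" "has_torus_derivative \<pi> \<rho> f L p"
  shows "torus_derivative \<pi> \<rho> f p = L"
  unfolding torus_derivative_def
  using has_torus_derivative_unique[OF assms(1)] assms(2) by (intro the_equality)

lemma has_torus_derivative_id: "has_torus_derivative \<pi> \<pi> id id p"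
  unfolding has_torus_derivative_def by (intro exI[of _ id]) auto

lemma has_torus_derivative_compose:
  assumes "has_torus_derivative \<pi> \<rho> f L p" "has_torus_derivative \<rho> \<tau> k M (f p)"
  shows "has_torus_derivative \<pi> \<tau> (k \<circ> f) (M \<circ> L) p"
proof -
  obtain \<phi> where \<phi>: "\<phi> 0 = 0" "(\<phi> has_derivative L) (at 0)" "\<And>h. f (p + \<pi> h) = f p + \<rho> (\<phi> h)"
    using assms(1) unfolding has_torus_derivative_def by blast
  obtain \<psi> where \<psi>: "\<psi> 0 = 0" "(\<psi> has_derivative M) (at 0)"
      "\<And>h. k (f p + \<rho> h) = k (f p) + \<tau> (\<psi> h)"
    using assms(2) unfolding has_torus_derivative_def by blast
  have "((\<psi> \<circ> \<phi>) has_derivative (M \<circ> L)) (at 0)"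
    using diff_chain_at[OF \<phi>(2)] \<phi>(1) \<psi>(2) by simp
  then show ?thesis
    unfolding has_torus_derivative_def using \<phi> \<psi> by (intro exI[of _ "\<psi> \<circ> \<phi>"]) simp
qed

lemma discrete_hom_map_prod:
  assumes "discrete_hom f" "discrete_hom g"
  shows "discrete_hom (map_prod f g)"
proof -
  interpret f: discrete_hom f by fact
  interpret g: discrete_hom g by fact
  obtain d where d: "d > 0" "\<And>x. norm x < d \<Longrightarrow> f x = 0 \<Longrightarrow> x = 0"
    using f.discrete_kernel by blast
  obtain e where e: "e > 0" "\<And>x. norm x < e \<Longrightarrow> g x = 0 \<Longrightarrow> x = 0"
    using g.discrete_kernel by blast
  have "x = 0" if "norm x < min d e" "map_prod f g x = 0" for x
    using that d(2)[of "fst x"] e(2)[of "snd x"] norm_fst_le[of "fst x" "snd x"]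
      norm_snd_le[of "snd x" "fst x"]
    by (auto simp: prod_eq_iff)
  moreover have "min d e > 0"
    using d e by simp
  ultimately show ?thesis
    by unfold_locales (simp add: f.add g.add prod_eq_iff, blast)
qed

section \<open>The circle and the tori as quotients by discrete homomorphisms\<close>

lemma to_circle_add: "to_circle (x + y) = to_circle x + to_circle y"
  by transfer simp

lemma to_circle_eq_0_iff: "to_circle x = 0 \<longleftrightarrow> x \<in> \<int>"
  by transfer simp

lemma discrete_hom_to_circle: "discrete_hom to_circle"
proof
  have "x = 0" if "norm x < 1" "to_circle x = 0" for x
    using that Ints_nonzero_abs_less1[of x] by (simp add: to_circle_eq_0_iff)
  then show "\<exists>e>0. \<forall>x. norm x < e \<longrightarrow> to_circle x = 0 \<longrightarrow> x = 0"
    by (intro exI[of _ 1]) auto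
qed (rule to_circle_add)

lemma discrete_hom_to_torus2: "discrete_hom to_torus2"
  unfolding to_torus2_def by (intro discrete_hom_map_prod discrete_hom_to_circle)

lemma discrete_hom_to_torus3: "discrete_hom to_torus3"
  unfolding to_torus3_def
  by (intro discrete_hom_map_prod discrete_hom_to_circle discrete_hom_to_torus2)

lemma to_circle_surj_unit_interval: "\<exists>x\<in>{0..1}. to_circle x = z"
proof -
  obtain x where "to_circle x = z"
    by transfer auto
  moreover have "to_circle (frac x) = to_circle x"
    by transfer (simp add: frac_def)
  ultimately show ?thesis
    using frac_lt_1[of x] by (intro bexI[of _ "frac x"]) auto
qed

text \<open>The unit square is a compact set that covers the torus, so a bound for a lifted function
  on it holds everywhere.\<close>

lemma to_torus2_surj_unit_square: "\<exists>x\<in>{0..1} \<times> {0..1}. to_torus2 x = p"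
  using to_circle_surj_unit_interval[of "fst p"] to_circle_surj_unit_interval[of "snd p"]
  by (force simp: to_torus2_def prod_eq_iff)

section \<open>Derivatives of smooth maps of tori\<close>

lemma C2_torus_map_has_torus_derivative:
  assumes "C2_torus_map \<pi> \<rho> f" "discrete_hom \<rho>"
  shows "has_torus_derivative \<pi> \<rho> f (torus_derivative \<pi> \<rho> f p) p"
  using assms torus_derivative_eqI unfolding C2_torus_map_def by metis

text \<open>The lifted derivative is differentiable, hence continuous, and so bounded on the compact
  unit square.\<close>

lemma C2_torus2_map_derivative_bounded:
  assumes "C2_torus_map to_torus2 to_torus2 f"
  obtains K where "\<And>p v. norm (D2 f p v) \<le> K * norm v"
proof -
  obtain D where D: "\<And>p. has_torus_derivative to_torus2 to_torus2 f (blinfun_apply (D p)) p"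
    and C1: "C1_map (\<lambda>x. D (to_torus2 x))"
    using assms unfolding C2_torus_map_def by blast
  obtain D' where "\<And>x. ((\<lambda>x. D (to_torus2 x)) has_derivative blinfun_apply (D' x)) (at x)"
    using C1 unfolding C1_map_def by blast
  then have "continuous_on ({0..1} \<times> {0..1}) (\<lambda>x. D (to_torus2 x))"
    by (rule has_derivative_continuous_on[OF has_derivative_at_withinI])
  then have "bounded ((\<lambda>x. D (to_torus2 x)) ` ({0..1} \<times> {0..1}))"
    by (intro compact_imp_bounded compact_continuous_image compact_Times compact_Icc)
  then obtain K where K: "\<And>x. x \<in> {0..1} \<times> {0..1} \<Longrightarrow> norm (D (to_torus2 x)) \<le> K"
    by (auto simp: bounded_iff)
  have "norm (D p) \<le> K" for p
    using K to_torus2_surj_unit_square[of p] by blast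
  then have "norm (D2 f p v) \<le> K * norm v" for p v
    unfolding torus_derivative_eqI[OF discrete_hom_to_torus2 D]
    by (meson norm_blinfun order_trans mult_right_mono norm_ge_zero)
  then show thesis
    by (rule that)
qed

lemma orientation_preserving_has_torus_derivative:
  assumes "orientation_preserving_C2_diffeo f"
  shows "has_torus_derivative to_circle to_circle f (\<lambda>t. circle_deriv f z * t) z"
proof -
  have D: "has_torus_derivative to_circle to_circle f (torus_derivative to_circle to_circle f z) z"
    using assms C2_torus_map_has_torus_derivative[OF _ discrete_hom_to_circle]
    unfolding orientation_preserving_C2_diffeo_def C2_torus_diffeo_def by blast
  then have lin: "linear (torus_derivative to_circle to_circle f z)"
    unfolding has_torus_derivative_def by (auto dest: has_derivative_linear)
  have "torus_derivative to_circle to_circle f z t = circle_deriv f z * t" for t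
    using linear_scale[OF lin, of t 1] by (simp add: circle_deriv_def)
  then have "torus_derivative to_circle to_circle f z = (\<lambda>t. circle_deriv f z * t)"
    by blast
  with D show ?thesis
    by simp
qed

section \<open>Differentials of the skew product and of iterates\<close>

lemma skew_product_has_torus_derivative:
  assumes A: "has_torus_derivative to_torus2 to_torus2 A L p"
    and r: "has_torus_derivative to_circle to_circle r (\<lambda>t. r' * t) (fst p)"
    and g: "has_torus_derivative to_circle to_circle g (\<lambda>t. g' * t) (z + r (fst p))"
  shows "has_torus_derivative to_torus3 to_torus3 (skew_product A g r)
    (\<lambda>(w, t). (L w, g' * (t + r' * fst w))) (p, z)"
proof -
  obtain \<alpha> where \<alpha>: "\<alpha> 0 = 0" "(\<alpha> has_derivative L) (at 0)"
      "\<And>h. A (p + to_torus2 h) = A p + to_torus2 (\<alpha> h)"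
    using A unfolding has_torus_derivative_def by blast
  obtain \<phi> where \<phi>: "\<phi> 0 = 0" "(\<phi> has_derivative (\<lambda>t. r' * t)) (at 0)"
      "\<And>h. r (fst p + to_circle h) = r (fst p) + to_circle (\<phi> h)"
    using r unfolding has_torus_derivative_def by blast
  obtain \<psi> where \<psi>: "\<psi> 0 = 0" "(\<psi> has_derivative (\<lambda>t. g' * t)) (at 0)"
      "\<And>h. g (z + r (fst p) + to_circle h) = g (z + r (fst p)) + to_circle (\<psi> h)"
    using g unfolding has_torus_derivative_def by blast
  \<comment> \<open>The lift has the same skew form: the increment of \<open>r\<close> is added to
    the fibre increment before the lift of \<open>g\<close> is applied.\<close>
  define \<Phi> where "\<Phi> = (\<lambda>h::(real \<times> real) \<times> real. (\<alpha> (fst h), \<psi> (snd h + \<phi> (fst (fst h)))))"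
  have \<alpha>': "((\<lambda>h::(real \<times> real) \<times> real. \<alpha> (fst h)) has_derivative (\<lambda>h. L (fst h))) (at 0)"
    by (rule has_derivative_compose[of fst fst, where g = \<alpha>])
      (auto intro!: derivative_eq_intros simp: \<alpha>(2))
  have "((\<lambda>h::(real \<times> real) \<times> real. \<phi> (fst (fst h))) has_derivative (\<lambda>h. r' * fst (fst h))) (at 0)"
    by (rule has_derivative_compose[where g = \<phi>])
      (auto intro!: derivative_eq_intros simp: \<phi>(2))
  then have "((\<lambda>h::(real \<times> real) \<times> real. snd h + \<phi> (fst (fst h)))
      has_derivative (\<lambda>h. snd h + r' * fst (fst h))) (at 0)"
    by (auto intro!: derivative_eq_intros)
  then have "((\<lambda>h::(real \<times> real) \<times> real. \<psi> (snd h + \<phi> (fst (fst h))))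
      has_derivative (\<lambda>h. g' * (snd h + r' * fst (fst h)))) (at 0)"
    by (rule has_derivative_compose[where g = \<psi>]) (simp add: \<phi>(1) \<psi>(2))
  from has_derivative_Pair[OF \<alpha>' this]
  have "(\<Phi> has_derivative (\<lambda>(w, t). (L w, g' * (t + r' * fst w)))) (at 0)"
    by (simp add: \<Phi>_def case_prod_unfold)
  moreover have "skew_product A g r ((p, z) + to_torus3 h)
      = skew_product A g r (p, z) + to_torus3 (\<Phi> h)" for h
  proof -
    obtain h1 h2 t where h: "h = ((h1, h2), t)"
      by (metis surj_pair)
    \<comment> \<open>Regrouping into base point plus increment brings the argument of
      \<open>g\<close> into the form required by the lift \<open>\<psi>\<close>.\<close>
    have "z + to_circle t + (r (fst p) + to_circle (\<phi> h1))
        = z + r (fst p) + to_circle (t + \<phi> h1)"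
      by (simp add: to_circle_add algebra_simps)
    with \<phi>(3)[of h1] \<psi>(3)[of "t + \<phi> h1"]
    have "g (z + to_circle t + r (fst p + to_circle h1))
        = g (z + r (fst p)) + to_circle (\<psi> (t + \<phi> h1))"
      by (simp only:)
    then show ?thesis
      using \<alpha>(3)[of "(h1, h2)"]
      by (cases p) (simp add: h skew_product_def to_torus3_def to_torus2_def \<Phi>_def)
  qed
  moreover have "\<Phi> 0 = 0"
    by (simp add: \<Phi>_def \<alpha>(1) \<phi>(1) \<psi>(1) prod_eq_iff)
  ultimately show ?thesis
    unfolding has_torus_derivative_def by blast
qed

lemma has_torus_derivative_funpow:
  assumes "\<And>p. has_torus_derivative \<pi> \<pi> f (L p) p"
  shows "\<exists>M. has_torus_derivative \<pi> \<pi> (f ^^ n) M p"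
proof (induction n)
  case 0
  then show ?case
    using has_torus_derivative_id by (auto simp: id_def)
next
  case (Suc n)
  then show ?case
    unfolding funpow.simps(2) by (blast intro: has_torus_derivative_compose assms)
qed

lemma torus_derivative_funpow_Suc:
  assumes "discrete_hom \<pi>" "\<And>p. has_torus_derivative \<pi> \<pi> f (L p) p"
  shows "torus_derivative \<pi> \<pi> (f ^^ Suc n) p v
    = torus_derivative \<pi> \<pi> f ((f ^^ n) p) (torus_derivative \<pi> \<pi> (f ^^ n) p v)"
proof -
  obtain M where M: "has_torus_derivative \<pi> \<pi> (f ^^ n) M p"
    using has_torus_derivative_funpow assms(2) by blast
  show ?thesis
    using torus_derivative_eqI[OF assms(1) has_torus_derivative_compose[OF M assms(2)]]
      torus_derivative_eqI[OF assms(1) M] torus_derivative_eqI[OF assms]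
    by (simp add: o_def)
qed

text \<open>Replaces cone membership by inequalities between two coordinates; membership in
  \<open>Ecu\<close> is automatic because \<open>Eu\<close> is a subspace containing
  \<open>du\<close>.\<close>

lemma mem_cone_u_iff:
  assumes "subspace (Eu (fst p))" "du (fst p) \<in> Eu (fst p)"
  shows "v \<in> cone_u Eu du s t p \<longleftrightarrow>
    (\<exists>x y. v = (x *\<^sub>R du (fst p), y) \<and> 0 \<le> x \<and> 0 \<le> y \<and> s * x \<le> y \<and> y \<le> t * x)"
proof -
  have "x *\<^sub>R (du (fst p), 0) + y *\<^sub>R ((0, 0), 1) = (x *\<^sub>R du (fst p), y)" for x y :: real
    by (simp add: prod_eq_iff)
  moreover have "(x *\<^sub>R du (fst p), y) \<in> Ecu Eu p" for x y :: real
    unfolding Ecu_def using subspace_scale[OF assms, of x]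
    by (auto simp: prod_eq_iff intro!: exI[of _ "x *\<^sub>R du (fst p)"])
  ultimately show ?thesis
    unfolding cone_u_def by auto
qed

theorem lemma4p1:
  fixes A :: "torus2 \<Rightarrow> torus2" and g r :: "circle \<Rightarrow> circle"
    and Es Eu :: "torus2 \<Rightarrow> (real \<times> real) set"
    and ds du :: "torus2 \<Rightarrow> real \<times> real"
    and \<alpha>s \<alpha>u :: "torus2 \<Rightarrow> real"
    and za zr :: circle
    and lamA lamgmax lamgmin \<alpha>umax \<alpha>umin c C \<beta> a b :: real
    and F :: "torus3 \<Rightarrow> torus3"
  assumes A: "anosov_diffeo A Es Eu lamA"
    and g: "north_south_diffeo g za zr"
    and lamg: "lamgmax = circle_deriv g zr" "lamgmin = circle_deriv g za"
    and r: "orientation_preserving_C2_diffeo r"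
    and A1: "lamA < lamgmin" "lamgmin < 1" "1 < lamgmax" "lamgmax < inverse lamA"
    and A2: "c > 0" "C > 0" "\<And>x. c \<le> circle_deriv r x \<and> circle_deriv r x \<le> C"
    and A3_transversal: "\<And>p. (0, 1) \<notin> Eu p \<and> (0, 1) \<notin> Es p"
    and A3_du: "\<And>p. du p \<in> Eu p \<and> norm (du p) = 1 \<and> fst (du p) > 0"
    and A3_ds: "\<And>p. ds p \<in> Es p \<and> norm (ds p) = 1 \<and> fst (ds p) < 0"
    and A3_\<beta>: "\<beta> > 0" "\<And>p. du p \<bullet> (1, 0) \<ge> \<beta>" "\<And>p. ds p \<bullet> (1, 0) \<le> - \<beta>"
    and A3_\<alpha>u: "\<And>p. D2 A p (du p) = \<alpha>u p *\<^sub>R du (A p)" "\<And>p. \<alpha>u p > 0"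
    and A3_\<alpha>s: "\<And>p. D2 A p (ds p) = \<alpha>s p *\<^sub>R ds (A p)" "\<And>p. \<alpha>s p > 0"
    and \<alpha>umax: "\<alpha>umax = (SUP p. \<alpha>u p)" and \<alpha>umin: "\<alpha>umin = (INF p. \<alpha>u p)"
    and F: "F = skew_product A g r"
    and a: "a = 2 * lamgmax * C / (\<alpha>umin - lamgmax)"
    and b: "b = lamgmin * c * \<beta> / \<alpha>umax"
  shows "\<exists>c0>0. \<exists>\<sigma>>0. b < a - \<sigma> \<and>
           (\<forall>p. D3 F p ` cone_u Eu du 0 a p \<subseteq> cone_u Eu du b (a - \<sigma>) (F p) \<and>
                (\<forall>v \<in> cone_u Eu du 0 a p. \<forall>n. 
                   norm (D3 (F ^^ n) p v) \<ge> c0 * lamA powi (- int n) * norm v))"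
proof -

  \<comment> \<open>Bounds for the base and fibre derivatives\<close>
  have Amap: "C2_torus_map to_torus2 to_torus2 A" and Binv: "C2_torus_map to_torus2 to_torus2 (inv A)"
    and bijA: "bij A" and Eu: "\<And>p. subspace (Eu p)"
    and contr: "\<And>p v. v \<in> Eu p \<Longrightarrow> norm (D2 (inv A) p v) \<le> lamA * norm v"
    using A unfolding anosov_diffeo_def C2_torus_diffeo_def by auto
  have du: "du p \<in> Eu p" "norm (du p) = 1" "\<beta> \<le> fst (du p)" "fst (du p) \<le> 1" for p
  proof -
    show "du p \<in> Eu p" "norm (du p) = 1" using A3_du by auto
    then show "fst (du p) \<le> 1"
      using norm_fst_le[of "fst (du p)" "snd (du p)"] by simp
    show "\<beta> \<le> fst (du p)" using A3_\<beta>(2)[of p] by (simp add: inner_prod_def)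
  qed
  note DA = C2_torus_map_has_torus_derivative[OF Amap discrete_hom_to_torus2]
  \<comment> \<open>By the chain rule the derivative of \<open>inv A\<close> at \<open>A p\<close>
    undoes that of \<open>A\<close> at \<open>p\<close>. Contraction applied to the image of the
    unit vector \<open>du p\<close> gives \<open>1 \<le> lamA * \<alpha>u p\<close>, which also
    forces \<open>lamA\<close> to be positive.\<close>
  have "inverse lamA \<le> \<alpha>u p \<and> 0 < lamA" for p
  proof -
    have "has_torus_derivative to_torus2 to_torus2 (inv A \<circ> A) (D2 (inv A) (A p) \<circ> D2 A p) p"
      by (rule has_torus_derivative_compose[OF DA
          C2_torus_map_has_torus_derivative[OF Binv discrete_hom_to_torus2]])
    then have "D2 (inv A) (A p) \<circ> D2 A p = id"
      using has_torus_derivative_unique[OF discrete_hom_to_torus2 _ has_torus_derivative_id]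
        bijA by (metis bij_is_inj inv_o_cancel)
    then have "norm (du p) \<le> lamA * norm (D2 A p (du p))"
      using contr[of "D2 A p (du p)" "A p"] subspace_scale[OF Eu du(1)]
      by (metis A3_\<alpha>u(1) comp_apply id_apply)
    then have *: "1 \<le> lamA * \<alpha>u p"
      using A3_\<alpha>u(2)[of p] by (simp add: A3_\<alpha>u(1) du(2))
    then have "0 < lamA"
      using A3_\<alpha>u(2)[of p] by (smt (verit) mult_nonpos_nonneg)
    with * show ?thesis
      by (simp add: field_simps)
  qed
  then have \<alpha>u_ge: "inverse lamA \<le> \<alpha>u p" and lamA: "0 < lamA" for p
    by auto
  \<comment> \<open>The supremum defining \<open>\<alpha>umax\<close> bounds
    \<open>\<alpha>u\<close> only once the range is known to be bounded above; \<open>K\<close>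
    supplies that bound.\<close>
  obtain K where K: "\<And>p v. norm (D2 A p v) \<le> K * norm v"
    using C2_torus2_map_derivative_bounded[OF Amap] by blast
  have "\<alpha>u p \<le> K" for p
    using K[of p "du p"] A3_\<alpha>u(2)[of p] by (simp add: A3_\<alpha>u(1) du(2))
  then have "bdd_above (range \<alpha>u)" and "bdd_below (range \<alpha>u)"
    using \<alpha>u_ge by (auto simp: bdd_above_def bdd_below_def)
  then have \<alpha>u_bounds: "\<alpha>umin \<le> \<alpha>u p" "\<alpha>u p \<le> \<alpha>umax" for p
    unfolding \<alpha>umax \<alpha>umin by (auto intro: cINF_lower cSUP_upper)
  have \<alpha>umin_gt: "lamgmax < \<alpha>umin"
  proof -
    have "inverse lamA \<le> \<alpha>umin"
      unfolding \<alpha>umin using \<alpha>u_ge by (intro cINF_greatest) auto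
    with A1 show ?thesis by simp
  qed
  have \<alpha>_le: "\<alpha>umin \<le> \<alpha>umax"
    using \<alpha>u_bounds order_trans by blast
  have lamgmin: "0 < lamgmin" and gop: "orientation_preserving_C2_diffeo g"
    and g_bounds: "lamgmin \<le> circle_deriv g z" "circle_deriv g z \<le> lamgmax" for z
    using g unfolding north_south_diffeo_def orientation_preserving_C2_diffeo_def lamg by auto

  \<comment> \<open>With this choice \<open>a - \<sigma>\<close> equals
    \<open>lamgmax * (a + C) / \<alpha>umin\<close>, the upper estimate for the slope of an image
    vector.\<close>
  define \<sigma> where "\<sigma> = lamgmax * C / \<alpha>umin"
  have \<sigma>: "0 < \<sigma>"
    using A1 A2 \<alpha>umin_gt by (simp add: \<sigma>_def)
  have a_eq: "(a - \<sigma>) * \<alpha>umin = lamgmax * (a + C)"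
  proof -
    have "a * (\<alpha>umin - lamgmax) = 2 * lamgmax * C"
      using \<alpha>umin_gt by (simp add: a)
    moreover have "\<sigma> * \<alpha>umin = lamgmax * C"
      using \<alpha>umin_gt A1 by (simp add: \<sigma>_def)
    ultimately show ?thesis
      by (simp add: algebra_simps)
  qed
  \<comment> \<open>The chain is \<open>b \<le> \<sigma> < a - \<sigma>\<close>. The first bound
    uses \<open>c * \<beta> \<le> C\<close>; the second holds since replacing the denominator
    \<open>\<alpha>umin - lamgmax\<close> of \<open>a\<close> by the larger
    \<open>\<alpha>umin\<close> gives \<open>2 * \<sigma>\<close>.\<close>
  have b_bounds: "0 \<le> b" "b < a - \<sigma>"
  proof -
    show "0 \<le> b"
      using lamgmin A2 A3_\<beta>(1) \<alpha>umin_gt A1 \<alpha>_le by (simp add: b)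
    have "\<beta> \<le> 1" "c \<le> C"
      using du(3,4) A2(3) order_trans by blast+
    then have "c * \<beta> \<le> C * 1"
      using A2 A3_\<beta>(1) by (intro mult_mono) auto
    then have "lamgmin * (c * \<beta>) \<le> lamgmax * C"
      using A1 lamgmin A2 A3_\<beta>(1) by (intro mult_mono) auto
    then have "b \<le> lamgmax * C / \<alpha>umin"
      unfolding b using \<alpha>_le \<alpha>umin_gt A1 A2 by (intro frac_le) (auto simp: mult.assoc)
    also have "\<dots> = 2 * lamgmax * C / \<alpha>umin - \<sigma>"
      by (simp add: \<sigma>_def)
    also have "\<dots> < a - \<sigma>"
      unfolding a using \<alpha>umin_gt A1 A2 by (simp add: divide_strict_left_mono)
    finally show "b < a - \<sigma>" .
  qed

  \<comment> \<open>Action of the differential on the cones\<close>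
  define DF where "DF = (\<lambda>p (w, t). (D2 A (fst p) w,
    circle_deriv g (snd p + r (fst (fst p))) * (t + circle_deriv r (fst (fst p)) * fst w)))"
  have DF: "has_torus_derivative to_torus3 to_torus3 F (DF p) p" for p
    using skew_product_has_torus_derivative[OF DA[of "fst p"]
        orientation_preserving_has_torus_derivative[OF r]
        orientation_preserving_has_torus_derivative[OF gop], of "snd p"]
    by (simp add: F DF_def)
  have D3F: "D3 F p = DF p" for p
    using torus_derivative_eqI[OF discrete_hom_to_torus3 DF] .
  have fstF: "fst (F p) = A (fst p)" for p
    by (cases p) (auto simp: F skew_product_def)
  note cone_iff = mem_cone_u_iff[OF Eu du(1)]

  \<comment> \<open>Despite the name this is the vertical component of the image vector, not a
    ratio; its bounds are stated relative to the horizontal component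
    \<open>\<alpha>u (fst p) * x\<close>.\<close>
  define slope where "slope = (\<lambda>p x y. circle_deriv g (snd p + r (fst (fst p))) *
    (y + circle_deriv r (fst (fst p)) * (x * fst (du (fst p)))))"
  have D3F_apply: "D3 F p (x *\<^sub>R du (fst p), y) = ((\<alpha>u (fst p) * x) *\<^sub>R du (fst (F p)), slope p x y)"
    for p x y
  proof -
    have "linear (D2 A (fst p))"
      using DA[of "fst p"] unfolding has_torus_derivative_def by (auto dest: has_derivative_linear)
    from linear_scale[OF this, of x] show ?thesis
      by (simp add: D3F DF_def slope_def fstF A3_\<alpha>u(1) mult.commute)
  qed
  have slope_bounds: "0 \<le> slope p x y" "b * (\<alpha>u (fst p) * x) \<le> slope p x y"
      "slope p x y \<le> (a - \<sigma>) * (\<alpha>u (fst p) * x)"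
    if xy: "0 \<le> x" "0 \<le> y" "y \<le> a * x" for p x y
  proof -
    let ?g = "circle_deriv g (snd p + r (fst (fst p)))" and ?r = "circle_deriv r (fst (fst p))"
      and ?d = "fst (du (fst p))"
    define s where "s = ?r * ?d"
    have dr: "c * \<beta> \<le> s" "s \<le> C * 1"
      unfolding s_def using A2 A3_\<beta>(1) du(3,4)[of "fst p"] by (intro mult_mono; smt (verit))+
    then have s: "0 \<le> s"
      using A2(1) A3_\<beta>(1) by (smt (verit) mult_pos_pos)
    \<comment> \<open>The upper estimate takes the extreme values \<open>y = a * x\<close> and
      \<open>s = C\<close>; the lower one below takes \<open>y = 0\<close> and
      \<open>s = c * \<beta>\<close>.\<close>
    have "?g * (y + s * x) \<le> lamgmax * (a * x + C * x)"
    proof (intro mult_mono add_mono mult_right_mono)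
      show "0 \<le> y + s * x"
        using xy s by simp
    qed (use xy s dr g_bounds A1 A2(2) in auto)
    also have "\<dots> = (a - \<sigma>) * (\<alpha>umin * x)"
      using arg_cong[OF a_eq, of "\<lambda>s. s * x"] by (simp add: algebra_simps)
    also have "\<dots> \<le> (a - \<sigma>) * (\<alpha>u (fst p) * x)"
      using xy \<alpha>u_bounds b_bounds by (intro mult_left_mono mult_right_mono) auto
    finally show "slope p x y \<le> (a - \<sigma>) * (\<alpha>u (fst p) * x)"
      by (simp add: slope_def s_def mult_ac)
    have "b * (\<alpha>u (fst p) * x) \<le> b * (\<alpha>umax * x)"
      using xy \<alpha>u_bounds b_bounds by (intro mult_left_mono mult_right_mono) auto
    \<comment> \<open>The factor \<open>\<alpha>umax\<close> cancels the denominator of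
      \<open>b\<close>. The summand 0 is kept so that it can be compared with \<open>y\<close>
      termwise.\<close>
    also have "\<dots> = lamgmin * (0 + c * \<beta> * x)"
      using \<alpha>umin_gt \<alpha>_le A1 by (simp add: b)
    also have "\<dots> \<le> ?g * (y + s * x)"
    proof (intro mult_mono add_mono mult_right_mono)
      show "0 \<le> ?g"
        using g_bounds lamgmin by (meson less_imp_le order_trans)
    qed (use xy s dr g_bounds A2(1) A3_\<beta>(1) in auto)
    finally show *: "b * (\<alpha>u (fst p) * x) \<le> slope p x y"
      by (simp add: slope_def s_def mult_ac)
    have "0 \<le> b * (\<alpha>u (fst p) * x)"
      using b_bounds xy A3_\<alpha>u(2)[of "fst p"] by simp
    with * show "0 \<le> slope p x y"
      by simp
  qed

  have incl: "D3 F p ` cone_u Eu du 0 a p \<subseteq> cone_u Eu du b (a - \<sigma>) (F p)" for p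
  proof (rule image_subsetI)
    fix v assume "v \<in> cone_u Eu du 0 a p"
    then obtain x y where v: "v = (x *\<^sub>R du (fst p), y)" and xy: "0 \<le> x" "0 \<le> y" "y \<le> a * x"
      unfolding cone_iff by blast
    have "0 \<le> \<alpha>u (fst p) * x"
      using xy A3_\<alpha>u(2)[of "fst p"] by simp
    then show "D3 F p v \<in> cone_u Eu du b (a - \<sigma>) (F p)"
      unfolding cone_iff v D3F_apply using slope_bounds[OF xy] by blast
  qed

  \<comment> \<open>Expansion along iterates\<close>
  have growth: "\<exists>x' y'. D3 (F ^^ n) p (x *\<^sub>R du (fst p), y) = (x' *\<^sub>R du (fst ((F ^^ n) p)), y') \<and>
      0 \<le> y' \<and> y' \<le> a * x' \<and> inverse lamA ^ n * x \<le> x'"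
    if xy: "0 \<le> x" "0 \<le> y" "y \<le> a * x" for p x y n
  proof (induction n)
    case 0
    then show ?case
      using xy torus_derivative_eqI[OF discrete_hom_to_torus3 has_torus_derivative_id, of p]
      by (auto simp: id_def)
  next
    case (Suc n)
    then obtain x' y' where IH: "D3 (F ^^ n) p (x *\<^sub>R du (fst p), y) = (x' *\<^sub>R du (fst ((F ^^ n) p)), y')"
      "0 \<le> y'" "y' \<le> a * x'" "inverse lamA ^ n * x \<le> x'"
      by blast
    let ?q = "(F ^^ n) p"
    \<comment> \<open>The invariant leaves out the sign of \<open>x'\<close>, which follows from its
      growth bound.\<close>
    have "0 \<le> inverse lamA ^ n * x"
      using xy lamA by simp
    with IH have x': "0 \<le> x'"
      by simp
    have "inverse lamA ^ Suc n * x = inverse lamA * (inverse lamA ^ n * x)"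
      by simp
    also have "\<dots> \<le> \<alpha>u (fst ?q) * x'"
      using IH \<alpha>u_ge xy lamA A3_\<alpha>u(2)[of "fst ?q"] by (intro mult_mono) auto
    finally have "inverse lamA ^ Suc n * x \<le> \<alpha>u (fst ?q) * x'" .
    \<comment> \<open>Weakening \<open>a - \<sigma>\<close> to \<open>a\<close> returns the image to
      the cone assumed by the induction.\<close>
    moreover have "slope ?q x' y' \<le> a * (\<alpha>u (fst ?q) * x')"
    proof -
      have "(a - \<sigma>) * (\<alpha>u (fst ?q) * x') \<le> a * (\<alpha>u (fst ?q) * x')"
        using \<sigma> x' A3_\<alpha>u(2)[of "fst ?q"] by (intro mult_right_mono) auto
      with slope_bounds(3)[OF x' IH(2,3)] show ?thesis
        by (rule order_trans)
    qed
    ultimately show ?case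
      using slope_bounds(1)[OF x' IH(2,3)] D3F_apply[of ?q x' y']
      unfolding torus_derivative_funpow_Suc[OF discrete_hom_to_torus3 DF] IH(1) by auto
  qed

  have a_pos: "0 < a"
    using b_bounds \<sigma> by simp
  \<comment> \<open>The constant arises because \<open>du\<close> is a unit vector: in the cone
    \<open>norm v \<le> x + y \<le> (1 + a) * x\<close>, while the norm of the image is at least its
    horizontal component.\<close>
  have expand: "inverse (1 + a) * lamA powi (- int n) * norm v \<le> norm (D3 (F ^^ n) p v)"
    if v_cone: "v \<in> cone_u Eu du 0 a p" for p v n
  proof -
    obtain x y where v: "v = (x *\<^sub>R du (fst p), y)" and xy: "0 \<le> x" "0 \<le> y" "y \<le> a * x"
      using v_cone unfolding cone_iff by blast
    obtain x' y' where Dv: "D3 (F ^^ n) p v = (x' *\<^sub>R du (fst ((F ^^ n) p)), y')"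
      and le: "inverse lamA ^ n * x \<le> x'"
      using growth[OF xy] v by blast
    have "norm v \<le> norm (x *\<^sub>R du (fst p)) + norm y"
      unfolding v by (rule norm_Pair_le)
    also have "\<dots> \<le> (1 + a) * x"
      using xy by (simp add: du(2) algebra_simps)
    finally have "inverse (1 + a) * norm v \<le> x"
      using a_pos by (simp add: field_simps)
    then have "inverse lamA ^ n * (inverse (1 + a) * norm v) \<le> inverse lamA ^ n * x"
      using lamA by (intro mult_left_mono) auto
    also have "\<dots> \<le> norm (x' *\<^sub>R du (fst ((F ^^ n) p)))"
      using le by (simp add: du(2))
    also have "\<dots> \<le> norm (D3 (F ^^ n) p v)"
      unfolding Dv by (rule norm_fst_le)
    finally show ?thesis
      by (simp add: power_int_minus power_inverse mult_ac)
  qed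

  show ?thesis
    using a_pos \<sigma> b_bounds(2) incl expand
    by (intro exI[of _ "inverse (1 + a)"] conjI exI[of _ \<sigma>]) auto
qed

end
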